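(* Let $T>0$ and consider the following data: for $i=1,2$ and $0\le t\le T$, $\ell_i(t)=\ell(t):=e^{-4t}$, $a_i(t)=b_i(t)=0$, $\xi_i^{+}=\xi_i^{-}=1$, and $$\psi_1^{+}(t,\omega,y)=y,\quad \psi_2^{+}(t,\omega,y)=y+\ell(t),\quad \psi_1^{-}(t,\omega,y)=2y,\quad \psi_2^{-}(t,\omega,y)=2y+\ell(t).$$ Call $(Y^{\pm,i},Z^{\pm,i},K^{\pm,i})_{i=1,2}$ a solution if $(Y^{\pm,i},Z^{\pm,i},K^{\pm,i})\in\mathcal{S}^2_c\times\mathcal{M}^{d,2}\times\mathcal{K}^2_c$ for $i=1,2$ and, $\mathbb{P}$-a.s., for all $0\le t\le T$ and $i=1,2$, $$Y_t^{+,i}=\xi_i^{+}+\int_t^T\psi_i^{+}(s,\omega,Y_s^{+,i})ds+(K_T^{+,i}-K_t^{+,i})-\int_t^TZ_s^{+,i}dB_s,$$ $$Y_t^{-,i}=\xi_i^{-}+\int_t^T\psi_i^{-}(s,\omega,Y_s^{-,i})ds-(K_T^{-,i}-K_t^{-,i})-\int_t^TZ_s^{-,i}dB_s,$$ and, for $(i,j)\in\{(1,2),(2,1)\}$, $$Y_t^{+,i}\ge(Y_t^{+,j}-\ell_i(t))\vee(Y_t^{-,i}-a_i(t)),\qquad Y_t^{-,i}\le(Y_t^{-,j}+\ell_i(t))\wedge(Y_t^{+,i}+b_i(t)),$$ $$\int_0^T\big[Y_t^{+,i}-(Y_t^{+,j}-\ell_i(t))\vee(Y_t^{-,i}-a_i(t))\big]dK_t^{+,i}=0,$$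 $$\int_0^T\big[(Y_t^{-,j}+\ell_i(t))\wedge(Y_t^{+,i}+b_i(t))-Y_t^{-,i}\big]dK_t^{-,i}=0.$$ Then the following two families of deterministic processes (with $K^{\pm,i}_0=0$) are two different solutions, so the solution is not unique: (a) $Y_t^{+,1}=Y_t^{-,1}=e^{T-t}$, $\;Y_t^{+,2}=Y_t^{-,2}=e^{T-t}+\frac13\left(e^{-4t}-e^{-3T-t}\right)$, $\;Z^{\pm,i}=0$, $\;K^{+,1}=K^{+,2}=0$, $\;dK_t^{-,1}=e^{T-t}dt$, $\;dK_t^{-,2}=\left[e^{T-t}+\frac13\left(e^{-4t}-e^{-3T-t}\right)\right]dt$; (b) $Y_t^{+,1}=Y_t^{-,1}=e^{2(T-t)}$, $\;Y_t^{+,2}=Y_t^{-,2}=e^{2(T-t)}+\frac12\left(e^{-4t}-e^{-2(T+t)}\right)$, $\;Z^{\pm,i}=0$, $\;K^{-,1}=K^{-,2}=0$, $\;dK_t^{+,1}=e^{2(T-t)}dt$, $\;dK_t^{+,2}=\left[e^{2(T-t)}+\frac12\left(e^{-4t}-e^{-2(T+t)}\right)\right]dt$.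
   Context: $(\Omega,\mathcal{F},\mathbb{P})$ is a fixed probability space carrying a standard $d$-dimensional Brownian motion $B=(B_t)_{0\le t\le T}$; $\mathbb{F}=(\mathcal{F}_t)_{0\le t\le T}$ is the natural filtration of $B$ completed with the $\mathbb{P}$-null sets of $\mathcal{F}$. $\mathcal{M}^{d,2}$ is the set of $\mathbb{F}$-progressively measurable $\mathbb{R}^d$-valued processes $w$ with $\mathbb{E}\int_0^T|w_s|^2ds<\infty$. $\mathcal{S}^2_c$ is the set of $\mathbb{F}$-progressively measurable continuous $\mathbb{R}$-valued processes $w$ with $\mathbb{E}[\sup_{0\le t\le T}|w_t|^2]<\infty$. $\mathcal{K}^2_c$ is the set of nondecreasing $K\in\mathcal{S}^2_c$ with $K_0=0$. Notation: $x\vee y=\max(x,y)$, $x\wedge y=\min(x,y)$. *)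

theory Defs
  imports "HOL-Probability.Probability"
begin

section \<open>Brownian motion and its completed natural filtration\<close>

definition natural_filtration ::
  "'a measure \<Rightarrow> (real \<Rightarrow> 'a \<Rightarrow> real ^ 'd) \<Rightarrow> real \<Rightarrow> 'a measure" where
  "natural_filtration M B t =
     sigma (space M) {B s -` A \<inter> space M | s A. s \<in> {0..t} \<and> A \<in> sets borel}"

definition completed_filtration ::
  "'a measure \<Rightarrow> (real \<Rightarrow> 'a \<Rightarrow> real ^ 'd) \<Rightarrow> real \<Rightarrow> 'a measure" where
  "completed_filtration M B t =
     sigma (space M) (sets (natural_filtration M B t) \<union> null_sets M)"

definition standard_brownian_motion ::
  "'a measure \<Rightarrow> real \<Rightarrow> (real \<Rightarrow> 'a \<Rightarrow> real ^ 'd) \<Rightarrow> bool" where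
  "standard_brownian_motion M T B \<longleftrightarrow>
     (\<forall>t\<in>{0..T}. B t \<in> borel_measurable M) \<and>
     (AE \<omega> in M. B 0 \<omega> = 0) \<and>
     (AE \<omega> in M. continuous_on {0..T} (\<lambda>t. B t \<omega>)) \<and>
     (\<forall>s t. 0 \<le> s \<and> s < t \<and> t \<le> T \<longrightarrow>
        prob_space.indep_set M (sets (natural_filtration M B s))
          {(\<lambda>\<omega>. B t \<omega> - B s \<omega>) -` A \<inter> space M | A. A \<in> sets borel} \<and>
        prob_space.indep_vars M (\<lambda>_. borel) (\<lambda>k \<omega>. (B t \<omega> - B s \<omega>) $ k) UNIV \<and>
        (\<forall>k. distributed M lborel (\<lambda>\<omega>. (B t \<omega> - B s \<omega>) $ k)
               (\<lambda>x. ennreal (normal_density 0 (sqrt (t - s)) x))))"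

section \<open>Spaces of processes\<close>

text \<open>A process on the time interval from 0 to T is a function \<open>w t \<omega>\<close> of which only the values for
  \<open>t\<close> in that interval matter.\<close>

definition progressive ::
  "real \<Rightarrow> (real \<Rightarrow> 'a measure) \<Rightarrow> (real \<Rightarrow> 'a \<Rightarrow> 'b::topological_space) \<Rightarrow> bool" where
  "progressive T F w \<longleftrightarrow>
     (\<forall>t\<in>{0..T}. (\<lambda>(s, \<omega>). w s \<omega>) \<in> borel_measurable (restrict_space borel {0..t} \<Otimes>\<^sub>M F t))"

definition M2 ::
  "'a measure \<Rightarrow> (real \<Rightarrow> 'a \<Rightarrow> real ^ 'd) \<Rightarrow> real \<Rightarrow> (real \<Rightarrow> 'a \<Rightarrow> real ^ 'd) set" where
  "M2 M B T = {w. progressive T (completed_filtration M B) w \<and>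
     (\<integral>\<^sup>+\<omega>. (\<integral>\<^sup>+s\<in>{0..T}. ennreal ((norm (w s \<omega>))\<^sup>2) \<partial>lborel) \<partial>M) < \<infinity>}"

definition S2c ::
  "'a measure \<Rightarrow> (real \<Rightarrow> 'a \<Rightarrow> real ^ 'd) \<Rightarrow> real \<Rightarrow> (real \<Rightarrow> 'a \<Rightarrow> real) set" where
  "S2c M B T = {w. progressive T (completed_filtration M B) w \<and>
     (\<forall>\<omega>\<in>space M. continuous_on {0..T} (\<lambda>t. w t \<omega>)) \<and>
     (\<integral>\<^sup>+\<omega>. (SUP t\<in>{0..T}. ennreal (\<bar>w t \<omega>\<bar>\<^sup>2)) \<partial>M) < \<infinity>}"

definition K2c ::
  "'a measure \<Rightarrow> (real \<Rightarrow> 'a \<Rightarrow> real ^ 'd) \<Rightarrow> real \<Rightarrow> (real \<Rightarrow> 'a \<Rightarrow> real) set" where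
  "K2c M B T = {K \<in> S2c M B T.
     \<forall>\<omega>\<in>space M. K 0 \<omega> = 0 \<and> mono_on {0..T} (\<lambda>t. K t \<omega>)}"

section \<open>The Ito integral\<close>

text \<open>A simple process is given by times \<open>\<tau> 0 \<le> \<dots> \<le> \<tau> n\<close> and bounded coefficients \<open>\<phi> k\<close>, measurable at
  time \<open>\<tau> k\<close>; its value on the interval from \<open>\<tau> k\<close> (excluded) to \<open>\<tau> (Suc k)\<close> (included) is \<open>\<phi> k\<close>.\<close>

definition simple_process ::
  "'a measure \<Rightarrow> (real \<Rightarrow> 'a \<Rightarrow> real ^ 'd) \<Rightarrow> real \<Rightarrow>
   nat \<Rightarrow> (nat \<Rightarrow> real) \<Rightarrow> (nat \<Rightarrow> 'a \<Rightarrow> real ^ 'd) \<Rightarrow> bool" where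
  "simple_process M B T n \<tau> \<phi> \<longleftrightarrow>
     (\<forall>k\<le>n. \<tau> k \<in> {0..T}) \<and> (\<forall>k<n. \<tau> k \<le> \<tau> (Suc k)) \<and>
     (\<forall>k<n. \<phi> k \<in> borel_measurable (completed_filtration M B (\<tau> k)) \<and>
            (\<exists>C. \<forall>\<omega>\<in>space M. norm (\<phi> k \<omega>) \<le> C))"

definition simple_value ::
  "nat \<Rightarrow> (nat \<Rightarrow> real) \<Rightarrow> (nat \<Rightarrow> 'a \<Rightarrow> real ^ 'd) \<Rightarrow> real \<Rightarrow> 'a \<Rightarrow> real ^ 'd" where
  "simple_value n \<tau> \<phi> t \<omega> = (\<Sum>k<n. indicat_real {\<tau> k<..\<tau> (Suc k)} t *\<^sub>R \<phi> k \<omega>)"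

definition simple_integral ::
  "(real \<Rightarrow> 'a \<Rightarrow> real ^ 'd) \<Rightarrow> nat \<Rightarrow> (nat \<Rightarrow> real) \<Rightarrow> (nat \<Rightarrow> 'a \<Rightarrow> real ^ 'd) \<Rightarrow>
   real \<Rightarrow> 'a \<Rightarrow> real" where
  "simple_integral B n \<tau> \<phi> t \<omega> =
     (\<Sum>k<n. \<phi> k \<omega> \<bullet> (B (min (\<tau> (Suc k)) t) \<omega> - B (min (\<tau> k) t) \<omega>))"

text \<open>\<open>has_ito_integral M B T Z I\<close>: the process \<open>I\<close> is a continuous version of the integral of \<open>Z\<close>
  against \<open>B\<close> from 0 to \<open>t\<close>, i.e. the \<open>L\<^sup>2\<close> limit of the integrals of simple processes which
  converge to \<open>Z\<close> in the norm of \<open>M2\<close>. By the Ito isometry such an \<open>I\<close> is unique up to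
  indistinguishability.\<close>

definition has_ito_integral ::
  "'a measure \<Rightarrow> (real \<Rightarrow> 'a \<Rightarrow> real ^ 'd) \<Rightarrow> real \<Rightarrow>
   (real \<Rightarrow> 'a \<Rightarrow> real ^ 'd) \<Rightarrow> (real \<Rightarrow> 'a \<Rightarrow> real) \<Rightarrow> bool" where
  "has_ito_integral M B T Z I \<longleftrightarrow>
     Z \<in> M2 M B T \<and>
     progressive T (completed_filtration M B) I \<and>
     (\<forall>\<omega>\<in>space M. continuous_on {0..T} (\<lambda>t. I t \<omega>)) \<and>
     (\<exists>n \<tau> \<phi>.
        (\<forall>m. simple_process M B T (n m) (\<tau> m) (\<phi> m)) \<and>
        (\<lambda>m. \<integral>\<^sup>+\<omega>. (\<integral>\<^sup>+s\<in>{0..T}.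
           ennreal ((norm (simple_value (n m) (\<tau> m) (\<phi> m) s \<omega> - Z s \<omega>))\<^sup>2) \<partial>lborel) \<partial>M)
          \<longlonglongrightarrow> 0 \<and>
        (\<forall>t\<in>{0..T}. (\<lambda>m. \<integral>\<^sup>+\<omega>.
           ennreal ((simple_integral B (n m) (\<tau> m) (\<phi> m) t \<omega> - I t \<omega>)\<^sup>2) \<partial>M) \<longlonglongrightarrow> 0))"

section \<open>The system of doubly reflected equations\<close>

text \<open>The path is extended by constants outside the interval from 0 to T, because
  \<^const>\<open>interval_measure\<close> expects a nondecreasing function on the whole real line.\<close>

definition stieltjes_measure :: "real \<Rightarrow> (real \<Rightarrow> real) \<Rightarrow> real measure" where
  "stieltjes_measure T k = interval_measure (\<lambda>t. k (max 0 (min t T)))"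

text \<open>All components are indexed by \<open>i \<in> {1, 2}\<close>.\<close>

record 'a rbsde_data =
  xi_plus :: "nat \<Rightarrow> 'a \<Rightarrow> real"
  xi_minus :: "nat \<Rightarrow> 'a \<Rightarrow> real"
  psi_plus :: "nat \<Rightarrow> real \<Rightarrow> 'a \<Rightarrow> real \<Rightarrow> real"
  psi_minus :: "nat \<Rightarrow> real \<Rightarrow> 'a \<Rightarrow> real \<Rightarrow> real"
  cost_l :: "nat \<Rightarrow> real \<Rightarrow> real"
  cost_a :: "nat \<Rightarrow> real \<Rightarrow> real"
  cost_b :: "nat \<Rightarrow> real \<Rightarrow> real"

record ('a, 'd::finite) rbsde_processes =
  Y_plus :: "nat \<Rightarrow> real \<Rightarrow> 'a \<Rightarrow> real"
  Y_minus :: "nat \<Rightarrow> real \<Rightarrow> 'a \<Rightarrow> real"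
  Z_plus :: "nat \<Rightarrow> real \<Rightarrow> 'a \<Rightarrow> real ^ 'd"
  Z_minus :: "nat \<Rightarrow> real \<Rightarrow> 'a \<Rightarrow> real ^ 'd"
  K_plus :: "nat \<Rightarrow> real \<Rightarrow> 'a \<Rightarrow> real"
  K_minus :: "nat \<Rightarrow> real \<Rightarrow> 'a \<Rightarrow> real"

definition lower_obstacle ::
  "'a rbsde_data \<Rightarrow> ('a, 'd::finite) rbsde_processes \<Rightarrow> nat \<Rightarrow> nat \<Rightarrow> real \<Rightarrow> 'a \<Rightarrow> real" where
  "lower_obstacle D S i j t \<omega> =
     max (Y_plus S j t \<omega> - cost_l D i t) (Y_minus S i t \<omega> - cost_a D i t)"

definition upper_obstacle ::
  "'a rbsde_data \<Rightarrow> ('a, 'd::finite) rbsde_processes \<Rightarrow> nat \<Rightarrow> nat \<Rightarrow> real \<Rightarrow> 'a \<Rightarrow> real" where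
  "upper_obstacle D S i j t \<omega> =
     min (Y_minus S j t \<omega> + cost_l D i t) (Y_plus S i t \<omega> + cost_b D i t)"

text \<open>The integrability clauses only say that the Lebesgue and Stieltjes integrals in the equations
  exist; without them a divergent Bochner integral would count as 0.\<close>

definition rbsde_solution ::
  "'a measure \<Rightarrow> (real \<Rightarrow> 'a \<Rightarrow> real ^ 'd) \<Rightarrow> real \<Rightarrow>
   'a rbsde_data \<Rightarrow> ('a, 'd) rbsde_processes \<Rightarrow> bool" where
  "rbsde_solution M B T D S \<longleftrightarrow>
     (\<forall>i\<in>{1, 2}.
        Y_plus S i \<in> S2c M B T \<and> Z_plus S i \<in> M2 M B T \<and> K_plus S i \<in> K2c M B T \<and>
        Y_minus S i \<in> S2c M B T \<and> Z_minus S i \<in> M2 M B T \<and> K_minus S i \<in> K2c M B T) \<and>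
     (\<exists>I_plus I_minus.
        (\<forall>i\<in>{1, 2}. has_ito_integral M B T (Z_plus S i) (I_plus i) \<and>
                    has_ito_integral M B T (Z_minus S i) (I_minus i)) \<and>
        (AE \<omega> in M. \<forall>i\<in>{1, 2}.
           set_integrable lborel {0..T} (\<lambda>s. psi_plus D i s \<omega> (Y_plus S i s \<omega>)) \<and>
           set_integrable lborel {0..T} (\<lambda>s. psi_minus D i s \<omega> (Y_minus S i s \<omega>)) \<and>
           (\<forall>t\<in>{0..T}.
              Y_plus S i t \<omega> = xi_plus D i \<omega>
                + (LBINT s:{t..T}. psi_plus D i s \<omega> (Y_plus S i s \<omega>))
                + (K_plus S i T \<omega> - K_plus S i t \<omega>)
                - (I_plus i T \<omega> - I_plus i t \<omega>) \<and>
              Y_minus S i t \<omega> = xi_minus D i \<omega>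
                + (LBINT s:{t..T}. psi_minus D i s \<omega> (Y_minus S i s \<omega>))
                - (K_minus S i T \<omega> - K_minus S i t \<omega>)
                - (I_minus i T \<omega> - I_minus i t \<omega>)))) \<and>
     (AE \<omega> in M. \<forall>(i, j)\<in>{(1, 2), (2, 1)}.
        (\<forall>t\<in>{0..T}. Y_plus S i t \<omega> \<ge> lower_obstacle D S i j t \<omega> \<and>
                    Y_minus S i t \<omega> \<le> upper_obstacle D S i j t \<omega>) \<and>
        set_integrable (stieltjes_measure T (\<lambda>t. K_plus S i t \<omega>)) {0..T}
          (\<lambda>t. Y_plus S i t \<omega> - lower_obstacle D S i j t \<omega>) \<and>
        (LINT t:{0..T}|stieltjes_measure T (\<lambda>t. K_plus S i t \<omega>).
           Y_plus S i t \<omega> - lower_obstacle D S i j t \<omega>) = 0 \<and>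
        set_integrable (stieltjes_measure T (\<lambda>t. K_minus S i t \<omega>)) {0..T}
          (\<lambda>t. upper_obstacle D S i j t \<omega> - Y_minus S i t \<omega>) \<and>
        (LINT t:{0..T}|stieltjes_measure T (\<lambda>t. K_minus S i t \<omega>).
           upper_obstacle D S i j t \<omega> - Y_minus S i t \<omega>) = 0)"

text \<open>Identification of solutions: the continuous components up to indistinguishability, the
  integrands \<open>Z\<close> almost everywhere for the product measure.\<close>

definition same_processes ::
  "'a measure \<Rightarrow> real \<Rightarrow> ('a, 'd::finite) rbsde_processes \<Rightarrow> ('a, 'd) rbsde_processes \<Rightarrow> bool" where
  "same_processes M T S S' \<longleftrightarrow>
     (AE \<omega> in M. \<forall>i\<in>{1, 2}. \<forall>t\<in>{0..T}.
        Y_plus S i t \<omega> = Y_plus S' i t \<omega> \<and> Y_minus S i t \<omega> = Y_minus S' i t \<omega> \<and>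
        K_plus S i t \<omega> = K_plus S' i t \<omega> \<and> K_minus S i t \<omega> = K_minus S' i t \<omega>) \<and>
     (AE (t, \<omega>) in lborel \<Otimes>\<^sub>M M. t \<in> {0..T} \<longrightarrow> (\<forall>i\<in>{1, 2}.
        Z_plus S i t \<omega> = Z_plus S' i t \<omega> \<and> Z_minus S i t \<omega> = Z_minus S' i t \<omega>))"

section \<open>The example\<close>

definition example_data :: "'a rbsde_data" where
  "example_data = \<lparr>
     xi_plus = (\<lambda>i \<omega>. 1),
     xi_minus = (\<lambda>i \<omega>. 1),
     psi_plus = (\<lambda>i t \<omega> y. if i = 1 then y else y + exp (- 4 * t)),
     psi_minus = (\<lambda>i t \<omega> y. if i = 1 then 2 * y else 2 * y + exp (- 4 * t)),
     cost_l = (\<lambda>i t. exp (- 4 * t)),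
     cost_a = (\<lambda>i t. 0),
     cost_b = (\<lambda>i t. 0)\<rparr>"

definition y_a :: "real \<Rightarrow> nat \<Rightarrow> real \<Rightarrow> real" where
  "y_a T i t = (if i = 1 then exp (T - t)
                else exp (T - t) + 1 / 3 * (exp (- 4 * t) - exp (- 3 * T - t)))"

definition y_b :: "real \<Rightarrow> nat \<Rightarrow> real \<Rightarrow> real" where
  "y_b T i t = (if i = 1 then exp (2 * (T - t))
                else exp (2 * (T - t)) + 1 / 2 * (exp (- 4 * t) - exp (- 2 * (T + t))))"

definition solution_a :: "real \<Rightarrow> ('a, 'd::finite) rbsde_processes" where
  "solution_a T = \<lparr>
     Y_plus = (\<lambda>i t \<omega>. y_a T i t),
     Y_minus = (\<lambda>i t \<omega>. y_a T i t),
     Z_plus = (\<lambda>i t \<omega>. 0),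
     Z_minus = (\<lambda>i t \<omega>. 0),
     K_plus = (\<lambda>i t \<omega>. 0),
     K_minus = (\<lambda>i t \<omega>. LBINT s:{0..t}. y_a T i s)\<rparr>"

definition solution_b :: "real \<Rightarrow> ('a, 'd::finite) rbsde_processes" where
  "solution_b T = \<lparr>
     Y_plus = (\<lambda>i t \<omega>. y_b T i t),
     Y_minus = (\<lambda>i t \<omega>. y_b T i t),
     Z_plus = (\<lambda>i t \<omega>. 0),
     Z_minus = (\<lambda>i t \<omega>. 0),
     K_plus = (\<lambda>i t \<omega>. LBINT s:{0..t}. y_b T i s),
     K_minus = (\<lambda>i t \<omega>. 0)\<rparr>"

end

(* Both families are of the form Y^+ = Y^- = y with y' = - (c y + g), where g is the common
   inhomogeneity of the generators and c = 1 in (a), c = 2 in (b). The generator with rate p then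
   leaves the drift (c - p) y dt, which K absorbs: K^- for p = 2, c = 1 and K^+ for p = 1, c = 2.
   Since the two components of y differ by at most l, each obstacle coincides with y itself, so every
   nondecreasing K satisfies the Skorokhod conditions. *)
theory Submission
  imports Defs
begin

section \<open>Integral calculus on the time interval\<close>

lemma set_lebesgue_integral_eq_integral_continuous:
  fixes f :: "real \<Rightarrow> real"
  assumes "continuous_on {a..b} f"
  shows "(LBINT s:{a..b}. f s) = integral {a..b} f"
  using assms by (intro set_borel_integral_eq_integral borel_integrable_atLeastAtMost')

text \<open>Integrate \<open>y' = - (c * y + g)\<close> over \<open>{t..T}\<close> and split the
  rate as \<open>c = p + (c - p)\<close>. The part with rate \<open>p\<close> becomes a generator
  integral; the remaining drift is written as an increment of an integral started at 0, the form in
  which the increments \<open>K T - K t\<close> occur.\<close>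

lemma linear_ode_integral_form:
  fixes y g :: "real \<Rightarrow> real"
  assumes deriv: "\<And>s. (y has_real_derivative - (c * y s + g s)) (at s)"
    and g: "continuous_on UNIV g"
    and t: "t \<in> {0..T}"
  shows "y t = y T + (LBINT s:{t..T}. p * y s + g s)
           + (c - p) * ((LBINT s:{0..T}. y s) - (LBINT s:{0..t}. y s))"
proof -
  have y: "continuous_on A y" for A
    by (intro DERIV_continuous_on) (rule has_field_derivative_at_within[OF deriv])
  have g': "continuous_on A g" for A
    using g continuous_on_subset by blast
  have iy: "y integrable_on {a..b}" for a b
    by (intro integrable_continuous_interval y)
  have ig: "(\<lambda>s. p * y s + g s) integrable_on {a..b}" for a b
    by (intro integrable_continuous_interval continuous_intros y g')
  have "((\<lambda>s. - (c * y s + g s)) has_integral y T - y t) {t..T}"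
    using t deriv unfolding has_real_derivative_iff_has_vector_derivative
    by (intro fundamental_theorem_of_calculus) (simp_all add: has_vector_derivative_at_within)
  from has_integral_neg[OF this]
  have "((\<lambda>s. c * y s + g s) has_integral y t - y T) {t..T}"
    by (simp add: algebra_simps)
  then have "y t - y T = integral {t..T} (\<lambda>s. c * y s + g s)"
    by (rule integral_unique[symmetric])
  also have "(\<lambda>s. c * y s + g s) = (\<lambda>s. (p * y s + g s) + (c - p) * y s)"
    by (auto simp: algebra_simps)
  also have "integral {t..T} \<dots> = integral {t..T} (\<lambda>s. p * y s + g s) + (c - p) * integral {t..T} y"
    using integral_add[OF ig, of "\<lambda>s. (c - p) * y s" t T] iy[of t T]
    by (auto simp: integrable_on_mult_right)
  finally have "y t = y T + integral {t..T} (\<lambda>s. p * y s + g s) + (c - p) * integral {t..T} y"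
    by simp
  moreover have "integral {t..T} y = integral {0..T} y - integral {0..t} y"
    using t Henstock_Kurzweil_Integration.integral_combine[OF _ _ iy[of 0 T], of t] by simp
  ultimately show ?thesis
    by (simp add: set_lebesgue_integral_eq_integral_continuous continuous_intros y g')
qed

lemma continuous_on_indefinite_LBINT:
  fixes y :: "real \<Rightarrow> real"
  assumes "continuous_on UNIV y"
  shows "continuous_on {0..T} (\<lambda>t. LBINT s:{0..t}. y s)"
proof -
  have y: "continuous_on A y" for A
    using assms continuous_on_subset by blast
  show ?thesis
    by (simp add: set_lebesgue_integral_eq_integral_continuous y
        indefinite_integral_continuous_1 integrable_continuous_interval)
qed

lemma mono_on_indefinite_LBINT:
  fixes y :: "real \<Rightarrow> real"
  assumes "continuous_on UNIV y" and pos: "\<And>s. s \<in> {0..T} \<Longrightarrow> 0 \<le> y s"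
  shows "mono_on {0..T} (\<lambda>t. LBINT s:{0..t}. y s)"
proof (intro mono_onI)
  fix s t assume st: "s \<in> {0..T}" "t \<in> {0..T}" "s \<le> t"
  have y: "continuous_on A y" for A
    using assms(1) continuous_on_subset by blast
  have "integral {0..s} y \<le> integral {0..t} y"
    using st by (intro integral_subset_le integrable_continuous_interval y) (auto intro!: pos)
  then show "(LBINT s:{0..s}. y s) \<le> (LBINT s:{0..t}. y s)"
    by (simp add: set_lebesgue_integral_eq_integral_continuous y)
qed

section \<open>Deterministic processes and the zero Ito integral\<close>

text \<open>The map factors through the time coordinate, where it is Borel by continuity, so any
  \<open>F\<close> is allowed.\<close>

lemma progressive_deterministic:
  assumes "continuous_on {0..T} f"
  shows "progressive T F (\<lambda>t \<omega>. f t)"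
  unfolding progressive_def
proof
  fix t assume t: "t \<in> {0..T}"
  have "f \<in> borel_measurable (restrict_space borel {0..t})"
    using t by (intro borel_measurable_continuous_on_restrict continuous_on_subset[OF assms]) auto
  then have "(\<lambda>x. f (fst x)) \<in> borel_measurable (restrict_space borel {0..t} \<Otimes>\<^sub>M F t)"
    by (rule measurable_compose[OF measurable_fst])
  then show "(\<lambda>(s, \<omega>). f s) \<in> borel_measurable (restrict_space borel {0..t} \<Otimes>\<^sub>M F t)"
    by (simp add: case_prod_beta')
qed

text \<open>A continuous path on a compact interval is bounded, and constants have finite
  expectation under a probability measure.\<close>

lemma S2c_deterministic:
  assumes "prob_space M" and f: "continuous_on {0..T} f"
  shows "(\<lambda>t \<omega>. f t) \<in> S2c M B T"
proof -
  interpret prob_space M by fact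
  have "bounded (f ` {0..T})"
    using f by (intro compact_imp_bounded compact_continuous_image) auto
  then obtain C where C: "\<forall>t\<in>{0..T}. \<bar>f t\<bar> \<le> C"
    by (auto simp: bounded_real)
  have "(SUP t\<in>{0..T}. ennreal (\<bar>f t\<bar>\<^sup>2)) \<le> ennreal (C\<^sup>2)"
    by (intro SUP_least ennreal_leI power_mono) (use C in auto)
  also have "\<dots> < \<infinity>"
    by simp
  finally show ?thesis
    using f by (simp add: S2c_def progressive_deterministic emeasure_space_1)
qed

lemma has_ito_integral_zero:
  assumes "T > 0"
  shows "has_ito_integral M B T (\<lambda>t \<omega>. 0) (\<lambda>t \<omega>. 0)"
  unfolding has_ito_integral_def M2_def
\<comment> \<open>The approximating simple processes have \<open>n = 0\<close> pieces and the single
  grid time 0, which lies in \<open>{0..T}\<close>. Their values and integrals are empty sums, so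
  both approximation errors vanish identically.\<close>
proof (intro conjI exI[of _ "\<lambda>_. 0"] exI[of _ "\<lambda>_ _. 0"] exI[of _ "\<lambda>_ _ _. 0"])
qed (use assms in \<open>auto simp: progressive_deterministic simple_process_def simple_value_def
      simple_integral_def\<close>)

section \<open>A criterion for deterministic solutions\<close>

text \<open>The common shape of families (a) and (b): one \<open>y\<close> serves both signs, so a
  single criterion covers both.\<close>

definition deterministic_processes ::
  "(nat \<Rightarrow> real \<Rightarrow> real) \<Rightarrow> (nat \<Rightarrow> real \<Rightarrow> real) \<Rightarrow> (nat \<Rightarrow> real \<Rightarrow> real) \<Rightarrow>
   ('a, 'd::finite) rbsde_processes" where
  "deterministic_processes y kp km = \<lparr>
     Y_plus = (\<lambda>i t \<omega>. y i t), Y_minus = (\<lambda>i t \<omega>. y i t),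
     Z_plus = (\<lambda>i t \<omega>. 0), Z_minus = (\<lambda>i t \<omega>. 0),
     K_plus = (\<lambda>i t \<omega>. kp i t), K_minus = (\<lambda>i t \<omega>. km i t)\<rparr>"

definition inhomogeneity :: "nat \<Rightarrow> real \<Rightarrow> real" where
  "inhomogeneity i t = (if i = 1 then 0 else exp (- 4 * t))"

text \<open>The factor \<open>1 *\<close> is kept so that both generators have the form
  \<open>p * u + g\<close> with \<open>p = 1\<close> and \<open>p = 2\<close>.\<close>

lemma psi_example_data:
  "psi_plus example_data i t \<omega> u = 1 * u + inhomogeneity i t"
  "psi_minus example_data i t \<omega> u = 2 * u + inhomogeneity i t"
  by (auto simp: example_data_def inhomogeneity_def)

lemma continuous_on_inhomogeneity: "continuous_on A (inhomogeneity i)"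
  unfolding inhomogeneity_def by (cases "i = 1") (auto intro!: continuous_intros)

text \<open>The drift left over by a generator of rate \<open>p\<close> is
  \<open>(c - p) * y\<close>. For \<open>p = 1\<close> it is the density of \<open>K_plus\<close>,
  for \<open>p = 2\<close> it is minus the density of \<open>K_minus\<close>; with \<open>y\<close>
  nonnegative, \<open>1 \<le> c \<le> 2\<close> makes both nondecreasing. The endpoints
  \<open>c = 1\<close> and \<open>c = 2\<close> yield (a) and (b).\<close>

lemma rbsde_solution_deterministic_processes:
  fixes M :: "'a measure" and B :: "real \<Rightarrow> 'a \<Rightarrow> real ^ 'd"
  assumes M: "prob_space M" and T: "T > 0"
    and deriv: "\<And>i s. i \<in> {1, 2} \<Longrightarrow>
      (y i has_real_derivative - (c * y i s + inhomogeneity i s)) (at s)"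
    and final: "\<And>i. i \<in> {1, 2} \<Longrightarrow> y i T = 1"
    and gap: "\<And>t. t \<in> {0..T} \<Longrightarrow> \<bar>y 1 t - y 2 t\<bar> \<le> exp (- 4 * t)"
    and pos: "\<And>i t. i \<in> {1, 2} \<Longrightarrow> t \<in> {0..T} \<Longrightarrow> 0 \<le> y i t"
    and c: "1 \<le> c" "c \<le> 2"
  shows "rbsde_solution M B T example_data (deterministic_processes y
           (\<lambda>i t. (c - 1) * (LBINT s:{0..t}. y i s)) (\<lambda>i t. (2 - c) * (LBINT s:{0..t}. y i s)))"
    (is "rbsde_solution M B T example_data ?S")
proof -
  define S where "S = ?S"
  have y: "continuous_on A (y i)" if "i \<in> {1, 2}" for A i
    by (intro DERIV_continuous_on) (rule has_field_derivative_at_within[OF deriv[OF that]])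
  have Y: "Y_plus S i = (\<lambda>t \<omega>. y i t)" "Y_minus S i = (\<lambda>t \<omega>. y i t)" for i
    by (auto simp: S_def deterministic_processes_def)
  have Z: "Z_plus S i = (\<lambda>t \<omega>. 0)" "Z_minus S i = (\<lambda>t \<omega>. 0)" for i
    by (auto simp: S_def deterministic_processes_def)
  have K: "K_plus S i = (\<lambda>t \<omega>. (c - 1) * (LBINT s:{0..t}. y i s))"
    "K_minus S i = (\<lambda>t \<omega>. (2 - c) * (LBINT s:{0..t}. y i s))" for i
    by (auto simp: S_def deterministic_processes_def)
  have K2c: "(\<lambda>t \<omega>. r * (LBINT s:{0..t}. y i s)) \<in> K2c M B T" if "i \<in> {1, 2}" "0 \<le> r" for i r
  proof -
    have "mono_on {0..T} (\<lambda>t. r * (LBINT s:{0..t}. y i s))"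
      using mono_on_indefinite_LBINT[OF y[OF that(1)] pos[OF that(1)], of T] that(2)
      by (auto simp: mono_on_def mult_left_mono)
    moreover have "(\<lambda>t \<omega>. r * (LBINT s:{0..t}. y i s)) \<in> S2c M B T"
      by (intro S2c_deterministic M continuous_intros continuous_on_indefinite_LBINT y that)
    ultimately show ?thesis
      using set_lebesgue_integral_eq_integral_continuous[of 0 0 "y i"] by (simp add: K2c_def)
  qed
  \<comment> \<open>Left general in \<open>p\<close>: the value 1 gives the equation for
    \<open>Y_plus\<close>, the value 2 the one for \<open>Y_minus\<close>.\<close>
  have eqn: "y i t = 1 + (LBINT s:{t..T}. p * y i s + inhomogeneity i s)
      + (c - p) * ((LBINT s:{0..T}. y i s) - (LBINT s:{0..t}. y i s))"
    if "i \<in> {1, 2}" "t \<in> {0..T}" for i t p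
    using linear_ode_integral_form[OF deriv[OF that(1)] continuous_on_inhomogeneity that(2), of p]
    by (simp add: final[OF that(1)])
  have int: "set_integrable lborel {0..T} (\<lambda>s. p * y i s + inhomogeneity i s)" if "i \<in> {1, 2}" for i p
    by (intro borel_integrable_atLeastAtMost' continuous_intros continuous_on_inhomogeneity y that)
  have xi: "xi_plus example_data i \<omega> = 1" "xi_minus example_data i \<omega> = 1" for i and \<omega> :: 'a
    by (auto simp: example_data_def)
  \<comment> \<open>Since \<open>cost_a\<close> and \<open>cost_b\<close> are 0, one entry of the
    maximum and of the minimum is \<open>y i t\<close> itself, and \<open>gap\<close> makes it the
    extremal one.\<close>
  have obstacle: "lower_obstacle example_data S i j t \<omega> = y i t"
    "upper_obstacle example_data S i j t \<omega> = y i t"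
    if "(i, j) \<in> {(1, 2), (2, 1)}" "t \<in> {0..T}" for i j t and \<omega> :: 'a
    using that gap[OF that(2)]
    by (auto simp: lower_obstacle_def upper_obstacle_def Y example_data_def)
  \<comment> \<open>With the indicator included, the Skorokhod integrands vanish on the whole line,
    hence are integrable with integral 0 for every Stieltjes measure.\<close>
  have zero: "indicat_real {0..T} t *\<^sub>R (y i t - lower_obstacle example_data S i j t \<omega>) = 0"
    "indicat_real {0..T} t *\<^sub>R (upper_obstacle example_data S i j t \<omega> - y i t) = 0"
    if "(i, j) \<in> {(1, 2), (2, 1)}" for i j t and \<omega> :: 'a
    using obstacle[OF that, of t \<omega>] by (auto simp: indicator_def)
  show ?thesis
    unfolding S_def[symmetric] rbsde_solution_def
  \<comment> \<open>As \<open>Z = 0\<close>, both families of Ito integrals are taken to be 0; this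
    is the source of the terms \<open>0 - 0\<close> below.\<close>
  proof (intro conjI exI[of _ "\<lambda>_ _ _. 0"])
    show "\<forall>i\<in>{1, 2}. Y_plus S i \<in> S2c M B T \<and> Z_plus S i \<in> M2 M B T \<and> K_plus S i \<in> K2c M B T \<and>
        Y_minus S i \<in> S2c M B T \<and> Z_minus S i \<in> M2 M B T \<and> K_minus S i \<in> K2c M B T"
      \<comment> \<open>Membership of the zero process in \<open>M2\<close> is read off from
        \<open>has_ito_integral\<close>.\<close>
      using has_ito_integral_zero[OF T, of M B] c
      unfolding Y Z K by (auto simp: has_ito_integral_def intro!: S2c_deterministic M y K2c)
  next
    show "\<forall>i\<in>{1, 2}. has_ito_integral M B T (Z_plus S i) (\<lambda>_ _. 0) \<and>
        has_ito_integral M B T (Z_minus S i) (\<lambda>_ _. 0)"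
      unfolding Z by (simp add: has_ito_integral_zero[OF T])
  next
    show "AE \<omega> in M. \<forall>i\<in>{1, 2}.
           set_integrable lborel {0..T} (\<lambda>s. psi_plus example_data i s \<omega> (Y_plus S i s \<omega>)) \<and>
           set_integrable lborel {0..T} (\<lambda>s. psi_minus example_data i s \<omega> (Y_minus S i s \<omega>)) \<and>
           (\<forall>t\<in>{0..T}.
              Y_plus S i t \<omega> = xi_plus example_data i \<omega>
                + (LBINT s:{t..T}. psi_plus example_data i s \<omega> (Y_plus S i s \<omega>))
                + (K_plus S i T \<omega> - K_plus S i t \<omega>) - (0 - 0) \<and>
              Y_minus S i t \<omega> = xi_minus example_data i \<omega>
                + (LBINT s:{t..T}. psi_minus example_data i s \<omega> (Y_minus S i s \<omega>))
                - (K_minus S i T \<omega> - K_minus S i t \<omega>) - (0 - 0))"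
      unfolding Y K xi psi_example_data
    proof (intro AE_I2 ballI conjI int)
      fix i t assume it: "i \<in> {1::nat, 2}" "t \<in> {0..T}"
      show "y i t = 1 + (LBINT s:{t..T}. 1 * y i s + inhomogeneity i s)
          + ((c - 1) * (LBINT s:{0..T}. y i s) - (c - 1) * (LBINT s:{0..t}. y i s)) - (0 - 0)"
        using eqn[OF it, of 1] by (simp only: right_diff_distrib)
      show "y i t = 1 + (LBINT s:{t..T}. 2 * y i s + inhomogeneity i s)
          - ((2 - c) * (LBINT s:{0..T}. y i s) - (2 - c) * (LBINT s:{0..t}. y i s)) - (0 - 0)"
        using eqn[OF it, of 2] by (simp only: algebra_simps)
    qed
  next
    show "AE \<omega> in M. \<forall>(i, j)\<in>{(1, 2), (2, 1)}.
        (\<forall>t\<in>{0..T}. Y_plus S i t \<omega> \<ge> lower_obstacle example_data S i j t \<omega> \<and>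
                    Y_minus S i t \<omega> \<le> upper_obstacle example_data S i j t \<omega>) \<and>
        set_integrable (stieltjes_measure T (\<lambda>t. K_plus S i t \<omega>)) {0..T}
          (\<lambda>t. Y_plus S i t \<omega> - lower_obstacle example_data S i j t \<omega>) \<and>
        (LINT t:{0..T}|stieltjes_measure T (\<lambda>t. K_plus S i t \<omega>).
           Y_plus S i t \<omega> - lower_obstacle example_data S i j t \<omega>) = 0 \<and>
        set_integrable (stieltjes_measure T (\<lambda>t. K_minus S i t \<omega>)) {0..T}
          (\<lambda>t. upper_obstacle example_data S i j t \<omega> - Y_minus S i t \<omega>) \<and>
        (LINT t:{0..T}|stieltjes_measure T (\<lambda>t. K_minus S i t \<omega>).
           upper_obstacle example_data S i j t \<omega> - Y_minus S i t \<omega>) = 0"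
    proof (intro AE_I2 ballI, clarify)
      fix \<omega> i j assume ij: "(i, j) \<in> {(1::nat, 2::nat), (2, 1)}"
      show "(\<forall>t\<in>{0..T}. Y_plus S i t \<omega> \<ge> lower_obstacle example_data S i j t \<omega> \<and>
                    Y_minus S i t \<omega> \<le> upper_obstacle example_data S i j t \<omega>) \<and>
        set_integrable (stieltjes_measure T (\<lambda>t. K_plus S i t \<omega>)) {0..T}
          (\<lambda>t. Y_plus S i t \<omega> - lower_obstacle example_data S i j t \<omega>) \<and>
        (LINT t:{0..T}|stieltjes_measure T (\<lambda>t. K_plus S i t \<omega>).
           Y_plus S i t \<omega> - lower_obstacle example_data S i j t \<omega>) = 0 \<and>
        set_integrable (stieltjes_measure T (\<lambda>t. K_minus S i t \<omega>)) {0..T}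
          (\<lambda>t. upper_obstacle example_data S i j t \<omega> - Y_minus S i t \<omega>) \<and>
        (LINT t:{0..T}|stieltjes_measure T (\<lambda>t. K_minus S i t \<omega>).
           upper_obstacle example_data S i j t \<omega> - Y_minus S i t \<omega>) = 0"
        unfolding set_integrable_def set_lebesgue_integral_def Y zero[OF ij]
        by (simp add: obstacle[OF ij])
    qed
  qed
qed

section \<open>The two explicit families and their difference\<close>

lemma rbsde_solution_a:
  fixes M :: "'a measure" and B :: "real \<Rightarrow> 'a \<Rightarrow> real ^ 'd"
  assumes "prob_space M" "T > 0"
  shows "rbsde_solution M B T example_data (solution_a T)"
proof -
  \<comment> \<open>Equivalent to \<open>t \<le> T\<close>. It places
    \<open>y_a T 2 t - y_a T 1 t\<close> between 0 and a third of \<open>exp (- 4 * t)\<close>,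
    which gives both the gap and the sign condition.\<close>
  have bounds: "exp (- 3 * T - t) \<le> exp (- 4 * t)" if "t \<in> {0..T}" for t
    using that by simp
  \<comment> \<open>The factors \<open>1 - 1\<close> and \<open>2 - 1\<close> stay unevaluated so
    that the criterion matches with \<open>c = 1\<close>.\<close>
  have "rbsde_solution M B T example_data (deterministic_processes (y_a T)
      (\<lambda>i t. (1 - 1) * (LBINT s:{0..t}. y_a T i s)) (\<lambda>i t. (2 - 1) * (LBINT s:{0..t}. y_a T i s)))"
  proof (rule rbsde_solution_deterministic_processes[OF assms])
    fix i :: nat and s :: real
    show "(y_a T i has_real_derivative - (1 * y_a T i s + inhomogeneity i s)) (at s)"
      unfolding y_a_def[abs_def] inhomogeneity_def
      by (cases "i = 1") (auto intro!: derivative_eq_intros simp: algebra_simps)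
  next
    fix t assume t: "t \<in> {0..T}"
    show "\<bar>y_a T 1 t - y_a T 2 t\<bar> \<le> exp (- 4 * t)"
      using bounds[OF t] by (simp add: y_a_def) (smt (verit) exp_gt_zero)
    show "0 \<le> y_a T i t" for i
      using bounds[OF t] by (simp add: y_a_def)
  qed (auto simp: y_a_def)
  then show ?thesis
    by (simp add: deterministic_processes_def solution_a_def)
qed

lemma rbsde_solution_b:
  fixes M :: "'a measure" and B :: "real \<Rightarrow> 'a \<Rightarrow> real ^ 'd"
  assumes "prob_space M" "T > 0"
  shows "rbsde_solution M B T example_data (solution_b T)"
proof -
  \<comment> \<open>Again equivalent to \<open>t \<le> T\<close>; here the difference of the
    components lies between 0 and half of \<open>exp (- 4 * t)\<close>.\<close>
  have bounds: "exp (- 2 * (T + t)) \<le> exp (- 4 * t)" if "t \<in> {0..T}" for t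
    using that by simp
  \<comment> \<open>Now \<open>c = 2\<close>, so the roles of \<open>K_plus\<close> and
    \<open>K_minus\<close> are exchanged.\<close>
  have "rbsde_solution M B T example_data (deterministic_processes (y_b T)
      (\<lambda>i t. (2 - 1) * (LBINT s:{0..t}. y_b T i s)) (\<lambda>i t. (2 - 2) * (LBINT s:{0..t}. y_b T i s)))"
  proof (rule rbsde_solution_deterministic_processes[OF assms])
    fix i :: nat and s :: real
    show "(y_b T i has_real_derivative - (2 * y_b T i s + inhomogeneity i s)) (at s)"
      unfolding y_b_def[abs_def] inhomogeneity_def
      by (cases "i = 1") (auto intro!: derivative_eq_intros simp: algebra_simps)
  next
    fix t assume t: "t \<in> {0..T}"
    show "\<bar>y_b T 1 t - y_b T 2 t\<bar> \<le> exp (- 4 * t)"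
      using bounds[OF t] by (simp add: y_b_def) (smt (verit) exp_gt_zero)
    show "0 \<le> y_b T i t" for i
      using bounds[OF t] by (simp add: y_b_def)
  qed (auto simp: y_b_def)
  then show ?thesis
    by (simp add: deterministic_processes_def solution_b_def)
qed

lemma not_same_processes:
  assumes "prob_space M" "T > 0"
  shows "\<not> same_processes M T (solution_a T :: ('a, 'd::finite) rbsde_processes) (solution_b T)"
proof
  interpret prob_space M by fact
  assume "same_processes M T (solution_a T :: ('a, 'd) rbsde_processes) (solution_b T)"
  then have "AE \<omega> in M. \<forall>i\<in>{1, 2}. \<forall>t\<in>{0..T}. y_a T i t = y_b T i t"
    unfolding same_processes_def by (auto simp: solution_a_def solution_b_def)
  \<comment> \<open>A sentence free of \<open>\<omega>\<close> that holds almost everywhere under a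
    probability measure is true.\<close>
  then have "\<forall>i\<in>{1, 2}. \<forall>t\<in>{0..T}. y_a T i t = y_b T i t"
    by simp
  \<comment> \<open>All components agree at the terminal time; at time 0 the first ones are
    \<open>exp T\<close> and \<open>exp (2 * T)\<close>, distinct for \<open>T > 0\<close>.\<close>
  then have "y_a T 1 0 = y_b T 1 0"
    using \<open>T > 0\<close> by auto
  then show False
    using \<open>T > 0\<close> by (simp add: y_a_def y_b_def)
qed

theorem mainTheorem2:
  fixes M :: "'a measure" and B :: "real \<Rightarrow> 'a \<Rightarrow> real ^ 'd" and T :: real
  assumes "prob_space M"
    and "T > 0"
    and "standard_brownian_motion M T B"
  shows "rbsde_solution M B T example_data (solution_a T)
       \<and> rbsde_solution M B T example_data (solution_b T)
       \<and> \<not> same_processes M T (solution_a T :: ('a, 'd) rbsde_processes) (solution_b T)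
       \<and> \<not> (\<forall>S S'. rbsde_solution M B T example_data S \<longrightarrow>
                  rbsde_solution M B T example_data S' \<longrightarrow> same_processes M T S S')"
  \<comment> \<open>The last conjunct follows from the other three, with (a) and (b) as the two
    solutions.\<close>
  using rbsde_solution_a[OF assms(1,2), of B] rbsde_solution_b[OF assms(1,2), of B]
    not_same_processes[OF assms(1,2)] by blast

end
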